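(* Let $n,k,d$ be positive integers with $k\le d<n$, let $\alpha>0$, and let $l$ be an integer with $1\le l\le\left\lfloor\frac{n}{n+1-k}\right\rfloor$. Put $$k_1=\left\lfloor\frac{n}{l}\right\rfloor-n+k,\quad d_1=\left\lfloor\frac{n}{l}\right\rfloor-n+d,\quad k_l=k-(l-1)\left\lfloor\frac{n}{l}\right\rfloor,\quad d_l=d-(l-1)\left\lfloor\frac{n}{l}\right\rfloor.$$ Then $$C^{\mathrm{exact}}_{n,k,d}\left(\alpha,\frac{d_1\alpha}{d-k+1}\right)\ \ge\ \left((l-1)k_1+\frac{k_l d_1}{d_l}\right)\alpha.$$
   Context: A distributed storage system (DSS) with parameters $(n,k,d)$ stores a file across $n$ nodes, each storing an amount $\alpha$ of information (e.g. $\alpha$ symbols over a finite field, where symbols may be split into arbitrarily many sub-symbols), such that the file can be reconstructed from the contents of any $k$ nodes, and any lost node can be repaired by contacting any $d$ of the remaining nodes, each of which transmits an amount $\beta$ to the replacement node, for a total repair bandwidth $\gamma=d\beta$. Repair is exact: the replacement node stores exactly the same content as the lost node. $C^{\mathrm{exact}}_{n,k,d}(\alpha,\gamma)$ denotes the maximum size of a file that can be stored by such an exact-repair DSS with $n$ nodes, node size (at most) $\alpha$ and total repair bandwidth $\gamma$. *)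

theory Defs
  imports Complex_Main "HOL-Computational_Algebra.Primes" "HOL-Library.Extended_Real" "HOL-Library.FuncSet"
begin

text \<open>Nodes are indexed by 0..n-1. A code over an alphabet of size q (a prime power,
  i.e. the size of a finite field) with node contents of at most a q-ary symbols and per-helper
  repair transmissions of at most b q-ary symbols. Files, node contents and repair messages
  are encoded as natural numbers (any finite alphabet embeds). The file is an element of the
  finite nonempty set M; c i m is the content of node i when the file is m.\<close>

definition exact_repair_dss ::
  "nat \<Rightarrow> nat \<Rightarrow> nat \<Rightarrow> nat \<Rightarrow> nat \<Rightarrow> nat \<Rightarrow> nat set \<Rightarrow> (nat \<Rightarrow> nat \<Rightarrow> nat) \<Rightarrow> bool" where
  "exact_repair_dss n k d q a b M c \<longleftrightarrow>
     finite M \<and> M \<noteq> {} \<and>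
     (\<forall>i<n. card (c i ` M) \<le> q ^ a) \<and>
     (\<forall>K. K \<subseteq> {0..<n} \<and> card K = k \<longrightarrow> inj_on (\<lambda>m. restrict (\<lambda>j. c j m) K) M) \<and>
     (\<forall>i<n. \<forall>H. H \<subseteq> {0..<n} - {i} \<and> card H = d \<longrightarrow>
        (\<exists>\<phi> :: nat \<Rightarrow> nat \<Rightarrow> nat.
           (\<forall>j\<in>H. card ((\<lambda>m. \<phi> j (c j m)) ` M) \<le> q ^ b) \<and>
           (\<exists>\<psi> :: (nat \<Rightarrow> nat) \<Rightarrow> nat.
              \<forall>m\<in>M. \<psi> (restrict (\<lambda>j. \<phi> j (c j m)) H) = c i m)))"

text \<open>A file size B (measured in field symbols) is achievable with node size alpha and total
  repair bandwidth gamma = d beta if, for some field size q and some subpacketization t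
  (each symbol split into t sub-symbols), there is an exact-repair code storing at most
  alpha*t sub-symbols per node, each helper sending at most beta*t sub-symbols, and the
  file carries log_q |M| sub-symbols, i.e. log_q |M| / t symbols.\<close>

definition dss_achievable :: "nat \<Rightarrow> nat \<Rightarrow> nat \<Rightarrow> real \<Rightarrow> real \<Rightarrow> real \<Rightarrow> bool" where
  "dss_achievable n k d \<alpha> \<gamma> B \<longleftrightarrow>
     (\<exists>q t a b M c. (\<exists>p e. prime (p::nat) \<and> e > 0 \<and> q = p ^ e) \<and> t > (0::nat) \<and>
        real a \<le> \<alpha> * real t \<and> real d * real b \<le> \<gamma> * real t \<and>
        exact_repair_dss n k d q a b M c \<and>
        B = log (real q) (real (card M)) / real t)"

definition C_exact :: "nat \<Rightarrow> nat \<Rightarrow> nat \<Rightarrow> real \<Rightarrow> real \<Rightarrow> ereal" where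
  "C_exact n k d \<alpha> \<gamma> = Sup {ereal B | B. dss_achievable n k d \<alpha> \<gamma> B}"

end

theory Submission
  imports Defs "HOL-Combinatorics.Permutations"
begin

text \<open>Split the nodes into \<open>l\<close> groups and use on each group a minimum storage regenerating code. Any
  \<open>k\<close> nodes miss at most \<open>n - k\<close> nodes of a group, and any \<open>d\<close> helpers together with the failed node
  miss at most \<open>n - d - 1\<close> of them, so every group can be decoded and repaired on its own. On a group
  we use the Ye--Barg construction, whose parity checks are generalised Reed--Solomon checks for
  every index vector \<open>a\<close>. In the resulting code the helpers outside the group of the failed node are
  idle; taking one copy of the code for every permutation of the nodes balances the load, because
  the transposition of two helpers exchanges their loads. Finally \<open>\<alpha>\<close> need not be a multiple of the
  node size, but the loss vanishes when the number of sub-symbols grows.\<close>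

section \<open>Array codes and symmetrization\<close>

text \<open>Elimination: check \<open>t + 1\<close> minus \<open>x i\<close> times check
  \<open>t\<close> removes the unknown at \<open>i\<close> and multiplies every other
  \<open>y j\<close> by \<open>x j - x i\<close>, which is invertible modulo \<open>p\<close>.
  Integers with divisibility stand in for the field with \<open>p\<close> elements.\<close>

lemma vandermonde_dvd:
  fixes p :: int and x y :: "'a \<Rightarrow> int"
  assumes "finite J" "prime p"
    and "\<And>i j. i \<in> J \<Longrightarrow> j \<in> J \<Longrightarrow> i \<noteq> j \<Longrightarrow> \<not> p dvd x i - x j"
    and "\<And>t. t < card J \<Longrightarrow> p dvd (\<Sum>j\<in>J. x j ^ t * y j)"
    and "j \<in> J"
  shows "p dvd y j"
  using assms(1,3-)
proof (induction J arbitrary: y j rule: finite_induct)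
  case empty
  then show ?case by simp
next
  case (insert i J)
  have *: "p dvd y j" if "j \<in> J" for j
  proof -
    have "p dvd (x j - x i) * y j"
    proof (rule insert.IH)
      fix t assume "t < card J"
      then have "p dvd (\<Sum>j\<in>insert i J. x j ^ Suc t * y j)" "p dvd (\<Sum>j\<in>insert i J. x j ^ t * y j)"
        using insert.hyps by (auto intro!: insert.prems(2) simp del: sum.insert power_Suc)
      then have "p dvd (\<Sum>j\<in>insert i J. x j ^ Suc t * y j) - x i * (\<Sum>j\<in>insert i J. x j ^ t * y j)"
        by (intro dvd_diff dvd_mult)
      also have "\<dots> = (\<Sum>j\<in>insert i J. x j ^ t * ((x j - x i) * y j))"
        unfolding sum_distrib_left sum_subtractf[symmetric] by (simp add: algebra_simps)
      also have "\<dots> = (\<Sum>j\<in>J. x j ^ t * ((x j - x i) * y j))"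
        using insert.hyps by simp
      finally show "p dvd (\<Sum>j\<in>J. x j ^ t * ((x j - x i) * y j))" .
    qed (use insert.prems(1) that in auto)
    moreover have "\<not> p dvd x j - x i"
      using insert.prems(1)[of j i] insert.hyps(2) that by auto
    ultimately show ?thesis using \<open>prime p\<close> by (auto simp: prime_dvd_mult_iff)
  qed
  \<comment> \<open>The check of exponent 0 recovers the eliminated unknown from the others.\<close>
  have "p dvd y i + (\<Sum>j\<in>J. y j)"
    using insert.prems(2)[of 0] insert.hyps by simp
  moreover have "p dvd (\<Sum>j\<in>J. y j)" using * by (intro dvd_sum) auto
  ultimately have "p dvd y i" by (simp add: dvd_add_left_iff)
  with * insert.prems(3) show ?case by auto
qed

text \<open>The number of \<open>q\<close>-ary symbols sent by helper \<open>j\<close> may depend on the failed node and on the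
  helper set. Injectivity and repair are phrased as separation of pairs of files, so that no
  decoding function has to be exhibited.\<close>

definition array_code ::
  "nat \<Rightarrow> nat \<Rightarrow> nat \<Rightarrow> nat \<Rightarrow> nat \<Rightarrow> (nat \<Rightarrow> nat set \<Rightarrow> nat \<Rightarrow> nat) \<Rightarrow> 'm set \<Rightarrow> (nat \<Rightarrow> 'm \<Rightarrow> 'x) \<Rightarrow> bool"
  where "array_code n k d q a \<omega> M c \<longleftrightarrow>
    finite M \<and> M \<noteq> {} \<and>
    (\<forall>i<n. card (c i ` M) \<le> q ^ a) \<and>
    (\<forall>K. K \<subseteq> {0..<n} \<and> card K = k \<longrightarrow>
      (\<forall>x\<in>M. \<forall>x'\<in>M. (\<forall>j\<in>K. c j x = c j x') \<longrightarrow> x = x')) \<and>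
    (\<forall>i<n. \<forall>H. H \<subseteq> {0..<n} - {i} \<and> card H = d \<longrightarrow>
      (\<exists>\<phi> :: nat \<Rightarrow> 'x \<Rightarrow> 'x.
        (\<forall>j\<in>H. card ((\<lambda>x. \<phi> j (c j x)) ` M) \<le> q ^ \<omega> i H j) \<and>
        (\<forall>x\<in>M. \<forall>x'\<in>M. (\<forall>j\<in>H. \<phi> j (c j x) = \<phi> j (c j x')) \<longrightarrow> c i x = c i x')))"

lemma array_codeI:
  fixes c :: "nat \<Rightarrow> 'm \<Rightarrow> 'x"
  assumes "finite M" "M \<noteq> {}" "\<And>i. i < n \<Longrightarrow> card (c i ` M) \<le> q ^ a"
    and "\<And>K x x'. K \<subseteq> {0..<n} \<Longrightarrow> card K = k \<Longrightarrow> x \<in> M \<Longrightarrow> x' \<in> M \<Longrightarrow>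
          (\<And>j. j \<in> K \<Longrightarrow> c j x = c j x') \<Longrightarrow> x = x'"
    and "\<And>i H. i < n \<Longrightarrow> H \<subseteq> {0..<n} - {i} \<Longrightarrow> card H = d \<Longrightarrow>
      (\<exists>\<phi> :: nat \<Rightarrow> 'x \<Rightarrow> 'x.
        (\<forall>j\<in>H. card ((\<lambda>x. \<phi> j (c j x)) ` M) \<le> q ^ \<omega> i H j) \<and>
        (\<forall>x\<in>M. \<forall>x'\<in>M. (\<forall>j\<in>H. \<phi> j (c j x) = \<phi> j (c j x')) \<longrightarrow> c i x = c i x'))"
  shows "array_code n k d q a \<omega> M c"
  unfolding array_code_def using assms by blast

lemma array_code_finite:
  assumes "array_code n k d q a \<omega> M c"
  shows "finite M" "M \<noteq> {}"
  using assms by (simp_all add: array_code_def)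

lemma array_code_node_size:
  assumes "array_code n k d q a \<omega> M c" "i < n"
  shows "card (c i ` M) \<le> q ^ a"
  using assms by (simp add: array_code_def)

lemma array_code_reconstruct:
  assumes "array_code n k d q a \<omega> M c" "K \<subseteq> {0..<n}" "card K = k" "x \<in> M" "x' \<in> M"
    and "\<And>j. j \<in> K \<Longrightarrow> c j x = c j x'"
  shows "x = x'"
  using assms by (simp add: array_code_def)

lemma array_code_repair:
  fixes c :: "nat \<Rightarrow> 'm \<Rightarrow> 'x"
  assumes "array_code n k d q a \<omega> M c" "i < n" "H \<subseteq> {0..<n} - {i}" "card H = d"
  shows "\<exists>\<phi> :: nat \<Rightarrow> 'x \<Rightarrow> 'x.
    (\<forall>j\<in>H. card ((\<lambda>x. \<phi> j (c j x)) ` M) \<le> q ^ \<omega> i H j) \<and>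
    (\<forall>x\<in>M. \<forall>x'\<in>M. (\<forall>j\<in>H. \<phi> j (c j x) = \<phi> j (c j x')) \<longrightarrow> c i x = c i x')"
  using assms by (simp add: array_code_def)

section \<open>From separation of files to decoding functions on natural numbers\<close>

text \<open>Files, contents and messages range over finite sets, so each kind embeds into the
  naturals without changing cardinalities. Separation then yields a decoder: every file compatible
  with the received messages has the right content at the failed node.\<close>

lemma array_code_imp_exact_repair_dss:
  fixes c :: "nat \<Rightarrow> 'm \<Rightarrow> 'x"
  assumes code: "array_code n k d q a \<omega> M c"
    and \<omega>: "\<And>i H j. i < n \<Longrightarrow> H \<subseteq> {0..<n} - {i} \<Longrightarrow> card H = d \<Longrightarrow> j \<in> H \<Longrightarrow> \<omega> i H j = b"
  shows "\<exists>M' c'. exact_repair_dss n k d q a b M' c' \<and> card M' = card M"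
proof -
  have fin: "finite M" "M \<noteq> {}" using array_code_finite[OF code] by auto
  obtain e :: "'m \<Rightarrow> nat" where e: "inj_on e M"
    using finite_imp_inj_to_nat_seg[OF fin(1)] by metis
  \<comment> \<open>All contents are collected so that a single \<open>h\<close> encodes every node
    injectively.\<close>
  define S where "S = (\<Union>i<n. c i ` M)"
  have "finite S" using fin by (auto simp: S_def)
  then obtain h :: "'x \<Rightarrow> nat" where h: "inj_on h S"
    using finite_imp_inj_to_nat_seg by metis
  define r where "r = inv_into M e"
  have r: "r (e x) = x" if "x \<in> M" for x using that e by (simp add: r_def)
  define c' where "c' = (\<lambda>i y. h (c i (r y)))"
  have c': "c' i (e x) = h (c i x)" if "x \<in> M" for i x using that by (simp add: c'_def r)
  have heq: "h (c i x) = h (c i x') \<longleftrightarrow> c i x = c i x'" if "i < n" "x \<in> M" "x' \<in> M" for i x x'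
    using that h by (auto simp: inj_on_def S_def)
  have "exact_repair_dss n k d q a b (e ` M) c'"
    unfolding exact_repair_dss_def
  proof (intro conjI allI impI)
    show "finite (e ` M)" "e ` M \<noteq> {}" using fin by auto
    fix i assume i: "i < n"
    have "c' i ` e ` M = h ` c i ` M" using c' by (simp add: image_image)
    moreover have "card (h ` c i ` M) \<le> card (c i ` M)" using fin by (intro card_image_le) auto
    moreover have "card (c i ` M) \<le> q ^ a" using code i by (rule array_code_node_size)
    ultimately show "card (c' i ` e ` M) \<le> q ^ a" by simp
  next
    fix K assume K: "K \<subseteq> {0..<n} \<and> card K = k"
    have sep: "x = x'" if "x \<in> M" "x' \<in> M" "\<And>j. j \<in> K \<Longrightarrow> c j x = c j x'" for x x'
      using array_code_reconstruct[OF code _ _ that] K by auto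
    show "inj_on (\<lambda>m. restrict (\<lambda>j. c' j m) K) (e ` M)"
    proof (rule inj_onI, clarify)
      fix x x' assume x: "x \<in> M" "x' \<in> M"
        and eq: "restrict (\<lambda>j. c' j (e x)) K = restrict (\<lambda>j. c' j (e x')) K"
      have "c j x = c j x'" if "j \<in> K" for j
      proof -
        have "j < n" using K that by auto
        moreover have "h (c j x) = h (c j x')" using fun_cong[OF eq, of j] that x by (simp add: c')
        ultimately show ?thesis using heq x by simp
      qed
      then show "e x = e x'" using sep x by blast
    qed
  next
    fix i H assume i: "i < n" and H: "H \<subseteq> {0..<n} - {i} \<and> card H = d"
    have H': "H \<subseteq> {0..<n} - {i}" "card H = d" using H by auto
    obtain \<phi> :: "nat \<Rightarrow> 'x \<Rightarrow> 'x" where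
        *: "(\<forall>j\<in>H. card ((\<lambda>x. \<phi> j (c j x)) ` M) \<le> q ^ \<omega> i H j) \<and>
          (\<forall>x\<in>M. \<forall>x'\<in>M. (\<forall>j\<in>H. \<phi> j (c j x) = \<phi> j (c j x')) \<longrightarrow> c i x = c i x')"
      using array_code_repair[OF code i H'] by (elim exE)
    have \<phi>: "card ((\<lambda>x. \<phi> j (c j x)) ` M) \<le> q ^ \<omega> i H j" if "j \<in> H" for j
      using * that by simp
    have rep: "c i x = c i x'"
      if "x \<in> M" "x' \<in> M" "\<And>j. j \<in> H \<Longrightarrow> \<phi> j (c j x) = \<phi> j (c j x')" for x x'
      by (rule mp[OF bspec[OF bspec[OF conjunct2[OF *] that(1)] that(2)]]) (rule ballI, rule that(3))
    \<comment> \<open>The encoding \<open>h'\<close> of messages may depend on the failed node and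
      the helper set, as the repair functions do.\<close>
    define V where "V = (\<Union>j\<in>H. (\<lambda>x. \<phi> j (c j x)) ` M)"
    have "finite H" using H finite_subset[of H "{0..<n} - {i}"] by auto
    then have "finite V" using fin by (auto simp: V_def)
    then obtain h' :: "'x \<Rightarrow> nat" where h': "inj_on h' V"
      using finite_imp_inj_to_nat_seg by metis
    define \<phi>' where "\<phi>' = (\<lambda>j z. h' (\<phi> j (inv_into S h z)))"
    have \<phi>': "\<phi>' j (c' j (e x)) = h' (\<phi> j (c j x))" if "j \<in> H" "x \<in> M" for j x
    proof -
      have "j < n" using that(1) H by auto
      then have "c j x \<in> S" using that(2) by (auto simp: S_def)
      then show ?thesis using that h by (simp add: \<phi>'_def c')
    qed
    define msg where "msg = (\<lambda>y. restrict (\<lambda>j. \<phi>' j (c' j y)) H)"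
    \<comment> \<open>The decoder picks any file that explains the messages; by \<open>rep\<close>
      the choice does not affect the content at \<open>i\<close>.\<close>
    define \<psi> where "\<psi> = (\<lambda>v. c' i (SOME y. y \<in> e ` M \<and> msg y = v))"
    show "\<exists>\<phi> :: nat \<Rightarrow> nat \<Rightarrow> nat. (\<forall>j\<in>H. card ((\<lambda>m. \<phi> j (c' j m)) ` e ` M) \<le> q ^ b) \<and>
          (\<exists>\<psi> :: (nat \<Rightarrow> nat) \<Rightarrow> nat. \<forall>m\<in>e ` M. \<psi> (restrict (\<lambda>j. \<phi> j (c' j m)) H) = c' i m)"
    proof (intro exI[of _ \<phi>'] exI[of _ \<psi>] conjI ballI)
      fix j assume j: "j \<in> H"
      have "(\<lambda>m. \<phi>' j (c' j m)) ` e ` M = h' ` (\<lambda>x. \<phi> j (c j x)) ` M"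
        using \<phi>'[OF j] by (simp add: image_image)
      also have "card \<dots> \<le> card ((\<lambda>x. \<phi> j (c j x)) ` M)" using fin by (intro card_image_le) auto
      also have "\<dots> \<le> q ^ b" using \<phi>[OF j] \<omega>[OF i _ _ j] H by simp
      finally show "card ((\<lambda>m. \<phi>' j (c' j m)) ` e ` M) \<le> q ^ b" .
    next
      fix y assume y: "y \<in> e ` M"
      define y' where "y' = (SOME y'. y' \<in> e ` M \<and> msg y' = msg y)"
      have y': "y' \<in> e ` M" "msg y' = msg y"
        using someI[of "\<lambda>y'. y' \<in> e ` M \<and> msg y' = msg y" y] y unfolding y'_def by auto
      from y y' obtain x x' where x: "x \<in> M" "y = e x" "x' \<in> M" "y' = e x'" by blast
      have "c i x' = c i x"
      proof (rule rep)
        fix j assume j: "j \<in> H"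
        have "h' (\<phi> j (c j x')) = h' (\<phi> j (c j x))"
          using fun_cong[OF y'(2), of j] x j by (simp add: msg_def \<phi>')
        then show "\<phi> j (c j x') = \<phi> j (c j x)"
          using h' j x by (auto simp: inj_on_def V_def)
      qed (use x in auto)
      then have "c' i y' = c' i y" using x by (simp add: c')
      then have "\<psi> (msg y) = c' i y" by (simp add: \<psi>_def y'_def)
      then show "\<psi> (restrict (\<lambda>j. \<phi>' j (c' j y)) H) = c' i y" by (simp add: msg_def)
    qed
  qed
  moreover have "card (e ` M) = card M" using e by (rule card_image)
  ultimately show ?thesis by blast
qed

section \<open>Independent copies and averaging over node permutations\<close>

lemma card_coordinatewise_image_le:
  assumes "finite I" "finite M" "\<And>z. z \<in> I \<Longrightarrow> card (f z ` M) \<le> q ^ e z"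
  shows "card ((\<lambda>x. \<lambda>z\<in>I. f z (x z)) ` (I \<rightarrow>\<^sub>E M)) \<le> (q::nat) ^ (\<Sum>z\<in>I. e z)"
proof -
  have "card ((\<lambda>x. \<lambda>z\<in>I. f z (x z)) ` (I \<rightarrow>\<^sub>E M)) \<le> card (PiE I (\<lambda>z. f z ` M))"
    using assms by (intro card_mono finite_PiE) auto
  also have "\<dots> = (\<Prod>z\<in>I. card (f z ` M))" using assms(1) by (rule card_PiE)
  also have "\<dots> \<le> (\<Prod>z\<in>I. q ^ e z)" using assms(3) by (intro prod_mono) auto
  also have "\<dots> = q ^ (\<Sum>z\<in>I. e z)" by (simp add: power_sum)
  finally show ?thesis .
qed

text \<open>A file is a family of independent files, one per copy, and node \<open>j\<close> plays
  the role of node \<open>\<sigma> z j\<close> in copy \<open>z\<close>. Each copy is decoded and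
  repaired separately, so sizes and loads add up.\<close>

lemma array_code_power:
  fixes c :: "nat \<Rightarrow> 'm \<Rightarrow> 'x" and I :: "'i set"
  assumes code: "array_code n k d q a \<omega> M c" and I: "finite I"
    and \<sigma>: "\<And>z. z \<in> I \<Longrightarrow> \<sigma> z permutes {0..<n}"
  shows "array_code n k d q (card I * a) (\<lambda>i H j. \<Sum>z\<in>I. \<omega> (\<sigma> z i) (\<sigma> z ` H) (\<sigma> z j))
           (I \<rightarrow>\<^sub>E M) (\<lambda>j x. \<lambda>z\<in>I. c (\<sigma> z j) (x z))"
proof -
  have fin: "finite M" "M \<noteq> {}" using array_code_finite[OF code] by auto
  have lt: "\<sigma> z i < n" if "z \<in> I" "i < n" for z i
    using permutes_in_image[OF \<sigma>[OF that(1)], of i] that(2) by simp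
  have card_im: "card (\<sigma> z ` X) = card X" if "z \<in> I" for z X
    using permutes_inj_on[OF \<sigma>[OF that]] by (rule card_image)
  have inj: "inj (\<sigma> z)" if "z \<in> I" for z using permutes_inj[OF \<sigma>[OF that]] .
  show ?thesis
  proof (rule array_codeI)
    show "finite (I \<rightarrow>\<^sub>E M)" using I fin by (intro finite_PiE) auto
    show "(I \<rightarrow>\<^sub>E M) \<noteq> {}" using fin by (simp add: PiE_eq_empty_iff)
  next
    fix i assume i: "i < n"
    have "card (c (\<sigma> z i) ` M) \<le> q ^ a" if "z \<in> I" for z
      using array_code_node_size[OF code lt[OF that i]] .
    then have "card ((\<lambda>x. \<lambda>z\<in>I. c (\<sigma> z i) (x z)) ` (I \<rightarrow>\<^sub>E M)) \<le> q ^ (\<Sum>z\<in>I. a)"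
      using I fin by (intro card_coordinatewise_image_le) auto
    then show "card ((\<lambda>x. \<lambda>z\<in>I. c (\<sigma> z i) (x z)) ` (I \<rightarrow>\<^sub>E M)) \<le> q ^ (card I * a)" by simp
  next
    fix K x x' assume K: "K \<subseteq> {0..<n}" "card K = k" and x: "x \<in> I \<rightarrow>\<^sub>E M" "x' \<in> I \<rightarrow>\<^sub>E M"
      and eq: "\<And>j. j \<in> K \<Longrightarrow> (\<lambda>z\<in>I. c (\<sigma> z j) (x z)) = (\<lambda>z\<in>I. c (\<sigma> z j) (x' z))"
    show "x = x'"
    proof (rule PiE_ext[OF x])
      fix z assume z: "z \<in> I"
      have eq': "c j (x z) = c j (x' z)" if j: "j \<in> \<sigma> z ` K" for j
      proof -
        obtain j' where "j' \<in> K" "j = \<sigma> z j'" using j by blast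
        then show ?thesis using fun_cong[OF eq, of j' z] z by simp
      qed
      have "\<sigma> z ` K \<subseteq> {0..<n}" using K lt[OF z] by auto
      moreover have "card (\<sigma> z ` K) = k" using K card_im[OF z] by simp
      moreover have "x z \<in> M" "x' z \<in> M" using x z by auto
      ultimately show "x z = x' z" using eq' by (rule array_code_reconstruct[OF code])
    qed
  next
    fix i H assume i: "i < n" and H: "H \<subseteq> {0..<n} - {i}" "card H = d"
    have "\<exists>\<phi> :: nat \<Rightarrow> 'x \<Rightarrow> 'x.
        (\<forall>j\<in>\<sigma> z ` H. card ((\<lambda>x. \<phi> j (c j x)) ` M) \<le> q ^ \<omega> (\<sigma> z i) (\<sigma> z ` H) j) \<and>
        (\<forall>x\<in>M. \<forall>x'\<in>M. (\<forall>j\<in>\<sigma> z ` H. \<phi> j (c j x) = \<phi> j (c j x')) \<longrightarrow> c (\<sigma> z i) x = c (\<sigma> z i) x')"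
      if z: "z \<in> I" for z
    proof -
      have "\<sigma> z ` H \<subseteq> {0..<n} - {\<sigma> z i}" using H lt[OF z] inj[OF z] by (auto simp: inj_eq)
      moreover have "card (\<sigma> z ` H) = d" using card_im[OF z] H(2) by simp
      ultimately show ?thesis by (rule array_code_repair[OF code lt[OF z i]])
    qed
    then have "\<forall>z\<in>I. \<exists>\<phi> :: nat \<Rightarrow> 'x \<Rightarrow> 'x.
        (\<forall>j\<in>\<sigma> z ` H. card ((\<lambda>x. \<phi> j (c j x)) ` M) \<le> q ^ \<omega> (\<sigma> z i) (\<sigma> z ` H) j) \<and>
        (\<forall>x\<in>M. \<forall>x'\<in>M. (\<forall>j\<in>\<sigma> z ` H. \<phi> j (c j x) = \<phi> j (c j x')) \<longrightarrow> c (\<sigma> z i) x = c (\<sigma> z i) x')"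
      by (rule ballI)
    from bchoice[OF this] obtain \<phi> :: "_ \<Rightarrow> nat \<Rightarrow> 'x \<Rightarrow> 'x" where *: "\<forall>z\<in>I.
        (\<forall>j\<in>\<sigma> z ` H. card ((\<lambda>x. \<phi> z j (c j x)) ` M) \<le> q ^ \<omega> (\<sigma> z i) (\<sigma> z ` H) j) \<and>
        (\<forall>x\<in>M. \<forall>x'\<in>M. (\<forall>j\<in>\<sigma> z ` H. \<phi> z j (c j x) = \<phi> z j (c j x')) \<longrightarrow> c (\<sigma> z i) x = c (\<sigma> z i) x')"
      by (elim exE)
    have \<phi>: "card ((\<lambda>x. \<phi> z j (c j x)) ` M) \<le> q ^ \<omega> (\<sigma> z i) (\<sigma> z ` H) j"
      if "z \<in> I" "j \<in> \<sigma> z ` H" for z j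
      using bspec[OF conjunct1[OF bspec[OF * that(1)]] that(2)] .
    have rep: "c (\<sigma> z i) x = c (\<sigma> z i) x'"
      if "z \<in> I" "x \<in> M" "x' \<in> M" "\<And>j. j \<in> \<sigma> z ` H \<Longrightarrow> \<phi> z j (c j x) = \<phi> z j (c j x')" for z x x'
      by (rule mp[OF bspec[OF bspec[OF conjunct2[OF bspec[OF * that(1)]] that(2)] that(3)]]) (rule ballI, rule that(4))
    define \<Phi> where "\<Phi> = (\<lambda>j y. \<lambda>z\<in>I. \<phi> z (\<sigma> z j) (y z))"
    have \<Phi>: "\<Phi> j (\<lambda>z\<in>I. c (\<sigma> z j) (x z)) = (\<lambda>z\<in>I. \<phi> z (\<sigma> z j) (c (\<sigma> z j) (x z)))" for j x
      by (auto simp: \<Phi>_def)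
    show "\<exists>\<Phi> :: nat \<Rightarrow> ('i \<Rightarrow> 'x) \<Rightarrow> 'i \<Rightarrow> 'x. (\<forall>j\<in>H. card ((\<lambda>x. \<Phi> j (\<lambda>z\<in>I. c (\<sigma> z j) (x z))) ` (I \<rightarrow>\<^sub>E M))
                \<le> q ^ (\<Sum>z\<in>I. \<omega> (\<sigma> z i) (\<sigma> z ` H) (\<sigma> z j))) \<and>
           (\<forall>x\<in>I \<rightarrow>\<^sub>E M. \<forall>x'\<in>I \<rightarrow>\<^sub>E M.
              (\<forall>j\<in>H. \<Phi> j (\<lambda>z\<in>I. c (\<sigma> z j) (x z)) = \<Phi> j (\<lambda>z\<in>I. c (\<sigma> z j) (x' z))) \<longrightarrow>
              (\<lambda>z\<in>I. c (\<sigma> z i) (x z)) = (\<lambda>z\<in>I. c (\<sigma> z i) (x' z)))"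
    proof (intro exI[of _ \<Phi>] conjI ballI impI)
      fix j assume j: "j \<in> H"
      show "card ((\<lambda>x. \<Phi> j (\<lambda>z\<in>I. c (\<sigma> z j) (x z))) ` (I \<rightarrow>\<^sub>E M))
              \<le> q ^ (\<Sum>z\<in>I. \<omega> (\<sigma> z i) (\<sigma> z ` H) (\<sigma> z j))"
        unfolding \<Phi> using I fin(1) \<phi> j
        by (intro card_coordinatewise_image_le[where f = "\<lambda>z y. \<phi> z (\<sigma> z j) (c (\<sigma> z j) y)"]) auto
    next
      fix x x' assume x: "x \<in> I \<rightarrow>\<^sub>E M" "x' \<in> I \<rightarrow>\<^sub>E M"
        and eq: "\<forall>j\<in>H. \<Phi> j (\<lambda>z\<in>I. c (\<sigma> z j) (x z)) = \<Phi> j (\<lambda>z\<in>I. c (\<sigma> z j) (x' z))"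
      have "c (\<sigma> z i) (x z) = c (\<sigma> z i) (x' z)" if z: "z \<in> I" for z
      proof (rule rep[OF z])
        show "x z \<in> M" "x' z \<in> M" using x z by auto
        fix j assume "j \<in> \<sigma> z ` H"
        then obtain j' where j': "j' \<in> H" "j = \<sigma> z j'" by blast
        show "\<phi> z j (c j (x z)) = \<phi> z j (c j (x' z))"
          using fun_cong[OF bspec[OF eq j'(1)], of z] z j'(2) by (simp add: \<Phi>)
      qed
      then show "(\<lambda>z\<in>I. c (\<sigma> z i) (x z)) = (\<lambda>z\<in>I. c (\<sigma> z i) (x' z))"
        by (auto simp: restrict_def)
    qed
  qed
qed

text \<open>Averaging over all permutations makes the load equal on all helpers, and the fixed total
  \<open>\<Gamma>\<close> per copy then determines it. The factor \<open>T\<close> repeats the whole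
  family, which later adapts the code to an arbitrary node size.\<close>

lemma array_code_symmetrize:
  fixes c :: "nat \<Rightarrow> 'm \<Rightarrow> 'x"
  assumes code: "array_code n k d q a \<omega> M c" and d: "0 < d" "d < n"
    and tot: "\<And>i H. i < n \<Longrightarrow> H \<subseteq> {0..<n} - {i} \<Longrightarrow> card H = d \<Longrightarrow> (\<Sum>j\<in>H. \<omega> i H j) = \<Gamma>"
  shows "\<exists>b M' c'. exact_repair_dss n k d q (fact n * T * a) b M' c' \<and>
           d * b = fact n * T * \<Gamma> \<and> card M' = card M ^ (fact n * T)"
proof -
  define P where "P = {\<pi>. \<pi> permutes {0..<n}}"
  define I where "I = P \<times> {..<T}"
  have finP: "finite P" by (simp add: P_def finite_permutations)
  have cardP: "card P = fact n" unfolding P_def by (rule card_permutations) auto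
  have I: "finite I" "card I = fact n * T" using finP cardP by (auto simp: I_def card_cartesian_product)
  define \<Omega> where "\<Omega> = (\<lambda>i H j. \<Sum>z\<in>I. \<omega> (fst z i) (fst z ` H) (fst z j))"
  \<comment> \<open>The division is exact; this is verified at the end from one concrete
    repair.\<close>
  define b where "b = fact n * T * \<Gamma> div d"
  have \<Omega>P: "\<Omega> i H j = T * (\<Sum>\<pi>\<in>P. \<omega> (\<pi> i) (\<pi> ` H) (\<pi> j))" for i H j
    unfolding \<Omega>_def I_def by (subst sum.cartesian_product[symmetric, where g = "\<lambda>\<pi> _. \<omega> (\<pi> i) (\<pi> ` H) (\<pi> j)", unfolded case_prod_unfold]) (simp add: sum_distrib_left)
  have \<Omega>: "d * \<Omega> i H j = fact n * T * \<Gamma>"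
    if iH: "i < n" "H \<subseteq> {0..<n} - {i}" "card H = d" and j: "j \<in> H" for i H j
  proof -
    have "(\<Sum>\<pi>\<in>P. \<omega> (\<pi> i) (\<pi> ` H) (\<pi> j')) = (\<Sum>\<pi>\<in>P. \<omega> (\<pi> i) (\<pi> ` H) (\<pi> j))" if j': "j' \<in> H" for j'
    proof -
      \<comment> \<open>Both helpers differ from \<open>i\<close> and lie in \<open>H\<close>, so
        this transposition fixes \<open>i\<close> and preserves \<open>H\<close>. Composing with it
        on the right is an involution of \<open>P\<close> that exchanges the two sums.\<close>
      let ?\<tau> = "Transposition.transpose j j'"
      have \<tau>: "?\<tau> permutes {0..<n}" using iH j j' by (intro permutes_swap_id) auto
      have "?\<tau> i = i" using iH j j' by (intro transpose_apply_other) auto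
      moreover have "?\<tau> ` H = H" using j j' by simp
      then have "(\<pi> \<circ> ?\<tau>) ` H = \<pi> ` H" for \<pi> :: "nat \<Rightarrow> nat" by (simp only: image_comp[symmetric])
      ultimately show ?thesis
        using \<tau>
        by (intro sum.reindex_bij_witness[of _ "\<lambda>\<pi>. \<pi> \<circ> ?\<tau>" "\<lambda>\<pi>. \<pi> \<circ> ?\<tau>"])
           (auto simp: P_def o_assoc[symmetric] simp del: image_comp intro: permutes_compose)
    qed
    then have "(\<Sum>j'\<in>H. \<Omega> i H j') = (\<Sum>j'\<in>H. \<Omega> i H j)" unfolding \<Omega>P by (intro sum.cong) auto
    then have "d * \<Omega> i H j = (\<Sum>j'\<in>H. \<Omega> i H j')" using iH(3) by simp
    \<comment> \<open>Within a single copy the total load is that of the permuted failure, to which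
      \<open>tot\<close> applies.\<close>
    also have "\<dots> = (\<Sum>z\<in>I. \<Sum>j'\<in>H. \<omega> (fst z i) (fst z ` H) (fst z j'))"
      unfolding \<Omega>_def by (rule sum.swap)
    also have "\<dots> = (\<Sum>z\<in>I. \<Gamma>)"
    proof (rule sum.cong[OF refl])
      fix z assume "z \<in> I"
      then have perm: "fst z permutes {0..<n}" by (auto simp: I_def P_def)
      have inj: "inj (fst z)" using permutes_inj[OF perm] .
      have lt: "fst z v < n \<longleftrightarrow> v < n" for v using permutes_in_image[OF perm, of v] by simp
      have "(\<Sum>j'\<in>H. \<omega> (fst z i) (fst z ` H) (fst z j')) = (\<Sum>j'\<in>fst z ` H. \<omega> (fst z i) (fst z ` H) j')"
        using inj by (subst sum.reindex) (auto intro: inj_on_subset)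
      also have "\<dots> = \<Gamma>"
        using iH inj by (intro tot) (auto simp: lt inj_eq card_image inj_on_subset)
      finally show "(\<Sum>j'\<in>H. \<omega> (fst z i) (fst z ` H) (fst z j')) = \<Gamma>" .
    qed
    finally show ?thesis using I by simp
  qed
  have "array_code n k d q (card I * a) \<Omega> (I \<rightarrow>\<^sub>E M) (\<lambda>j x. \<lambda>z\<in>I. c (fst z j) (x z))"
    unfolding \<Omega>_def using code I(1) by (rule array_code_power) (auto simp: I_def P_def)
  moreover have "\<Omega> i H j = b" if "i < n" "H \<subseteq> {0..<n} - {i}" "card H = d" "j \<in> H" for i H j
    using \<Omega>[OF that] d(1) by (metis b_def less_not_refl nonzero_mult_div_cancel_left)
  ultimately obtain M' c' where "exact_repair_dss n k d q (card I * a) b M' c'" "card M' = card (I \<rightarrow>\<^sub>E M)"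
    using array_code_imp_exact_repair_dss[where b = b] by blast
  moreover have "d * b = fact n * T * \<Gamma>"
  proof -
    \<comment> \<open>Repairing node 0 from nodes 1 to \<open>d\<close> exhibits
      \<open>fact n * T * \<Gamma>\<close> as a multiple of \<open>d\<close>.\<close>
    have "{1..d} \<subseteq> {0..<n} - {0}" using d by auto
    then have "d * \<Omega> 0 {1..d} 1 = fact n * T * \<Gamma>" using d by (intro \<Omega>) auto
    then have "d dvd fact n * T * \<Gamma>" by (metis dvd_triv_left)
    then show ?thesis unfolding b_def by (rule dvd_mult_div_cancel)
  qed
  moreover have "card (I \<rightarrow>\<^sub>E M) = card M ^ card I" using I(1) by (simp add: card_PiE)
  ultimately show ?thesis unfolding I(2) by metis
qed

section \<open>Ye--Barg codes on groups of nodes\<close>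

text \<open>Here \<open>s\<close> is \<open>d - k + 1\<close>, the base of the digits;
  \<open>g\<close> assigns nodes to groups and \<open>w h\<close> is the number of copies used on
  group \<open>h\<close>. The bound on \<open>p\<close> leaves room for the \<open>n * s\<close>
  evaluation points.\<close>

locale grouped_code =
  fixes n k d s p l :: nat and g w :: "nat \<Rightarrow> nat"
  assumes prime: "prime p" and p_gt: "n * s < p" and s_pos: "0 < s"
    and s_eq: "d + 1 = k + s" and d_less: "d < n"
    and g_less: "\<And>i. i < n \<Longrightarrow> g i < l"
begin

text \<open>A position \<open>(i, u, a)\<close> in \<open>\<Omega>\<close> is the symbol of node
  \<open>i\<close> in row \<open>a\<close> of copy \<open>u\<close>. \<open>W\<close> consists of
  all words, before any check is imposed, and \<open>Q\<close> indexes the checks: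
  \<open>n - k\<close> powers for each row of each copy.\<close>

definition G where "G h = {i. i < n \<and> g i = h}"
definition A where "A = {..<n} \<rightarrow>\<^sub>E {..<s}"
definition \<Omega> where "\<Omega> = (SIGMA i:{..<n}. {..<w (g i)} \<times> A)"
definition W where "W = (\<Omega> \<rightarrow>\<^sub>E {..<p})"
definition Q where "Q = (SIGMA h:{..<l}. {..<w h} \<times> A \<times> {..<n - k})"

text \<open>The parity checks of Ye and Barg: the node \<open>i\<close> acts by diagonal matrices, with a separate
  evaluation point for every digit \<open>a i\<close>.\<close>

definition syn :: "(nat \<times> nat \<times> (nat \<Rightarrow> nat) \<Rightarrow> nat) \<Rightarrow> nat \<times> nat \<times> (nat \<Rightarrow> nat) \<times> nat \<Rightarrow> nat"
  where "syn x = (\<lambda>(h, u, a, t)\<in>Q. (\<Sum>i\<in>G h. (i * s + a i) ^ t * x (i, u, a)) mod p)"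

definition node :: "nat \<Rightarrow> (nat \<times> nat \<times> (nat \<Rightarrow> nat) \<Rightarrow> nat) \<Rightarrow> nat \<times> (nat \<Rightarrow> nat) \<Rightarrow> nat"
  where "node i x = (\<lambda>(u, a)\<in>{..<w (g i)} \<times> A. x (i, u, a))"

text \<open>The index \<open>i\<close> is the failed node, while \<open>z\<close> is the content of
  a helper in the same group. Rows with \<open>a i = 0\<close> represent the classes of rows that
  differ only in digit \<open>i\<close>, so a helper sends a fraction \<open>1 / s\<close> of its
  content.\<close>

definition msg :: "nat \<Rightarrow> (nat \<times> (nat \<Rightarrow> nat) \<Rightarrow> nat) \<Rightarrow> nat \<times> (nat \<Rightarrow> nat) \<Rightarrow> nat"
  where "msg i z = (\<lambda>(u, a)\<in>{..<w (g i)} \<times> {a \<in> A. a i = 0}. (\<Sum>v<s. z (u, a(i := v))) mod p)"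

lemma finite_G: "finite (G h)"
  by (simp add: G_def)

lemma finite_A: "finite A"
  by (simp add: A_def finite_PiE)

lemma card_A: "card A = s ^ n"
  by (simp add: A_def card_PiE)

lemma A_upd: "a \<in> A \<Longrightarrow> i < n \<Longrightarrow> v < s \<Longrightarrow> a(i := v) \<in> A"
  unfolding A_def using PiE_fun_upd[of v "\<lambda>_. {..<s}" i a "{..<n}"] by (simp add: insert_absorb)

lemma A_less: "a \<in> A \<Longrightarrow> i < n \<Longrightarrow> a i < s"
  unfolding A_def by auto

lemma finite_\<Omega>: "finite \<Omega>"
  using finite_A by (auto simp: \<Omega>_def)

lemma finite_Q: "finite Q"
  using finite_A by (auto simp: Q_def)

lemma finite_W: "finite W"
  using finite_\<Omega> by (auto simp: W_def intro: finite_PiE)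

lemma card_\<Omega>: "card \<Omega> = (\<Sum>h<l. card (G h) * (w h * s ^ n))"
proof -
  have "card \<Omega> = (\<Sum>i<n. w (g i) * s ^ n)"
    using finite_A by (simp add: \<Omega>_def card_SigmaI card_cartesian_product card_A)
  also have "\<dots> = (\<Sum>h<l. \<Sum>i\<in>{i\<in>{..<n}. g i = h}. w (g i) * s ^ n)"
    using g_less by (intro sum.group[symmetric]) auto
  also have "\<dots> = (\<Sum>h<l. card (G h) * (w h * s ^ n))"
    by (intro sum.cong refl) (simp add: G_def)
  finally show ?thesis .
qed

lemma card_Q: "card Q = (\<Sum>h<l. (n - k) * (w h * s ^ n))"
  using finite_A by (simp add: Q_def card_SigmaI card_cartesian_product card_A algebra_simps)

lemma p_pos: "0 < p"
  using prime prime_gt_0_nat by blast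

text \<open>By pigeonhole some coset of the linear code is large, which is all that is needed; no rank
  computation is required.\<close>

lemma large_coset:
  assumes "\<And>h. h < l \<Longrightarrow> n - k \<le> card (G h)"
  shows "\<exists>y. p ^ (\<Sum>h<l. (card (G h) - (n - k)) * (w h * s ^ n)) \<le> card {x \<in> W. syn x = y}"
    (is "\<exists>y. p ^ ?F \<le> _")
proof -
  define S where "S = (Q \<rightarrow>\<^sub>E {..<p})"
  have fS: "finite S" using finite_Q by (auto simp: S_def intro: finite_PiE)
  have "S \<noteq> {}" using p_pos by (auto simp: S_def PiE_eq_empty_iff)
  moreover have "syn \<in> W \<rightarrow> S" using p_pos by (auto simp: syn_def S_def split: prod.splits)
  ultimately obtain y where "card (syn -` {y} \<inter> W) * card S \<ge> card W"
    using pigeonhole_card[of syn W S] finite_W fS by auto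
  moreover have "syn -` {y} \<inter> W = {x \<in> W. syn x = y}" by auto
  moreover have "card W = p ^ card \<Omega>" using finite_\<Omega> by (simp add: W_def card_PiE)
  moreover have S: "card S = p ^ card Q" using finite_Q by (simp add: S_def card_PiE)
  \<comment> \<open>Symbols minus checks, group by group; the assumption on group sizes keeps the
    natural subtraction exact.\<close>
  moreover have "card \<Omega> = ?F + card Q"
    unfolding card_\<Omega> card_Q sum.distrib[symmetric] using assms
    by (intro sum.cong refl) (simp add: add_mult_distrib[symmetric])
  ultimately have "p ^ ?F * p ^ card Q \<le> card {x \<in> W. syn x = y} * p ^ card Q"
    by (simp add: power_add)
  then show ?thesis using p_pos by auto
qed

section \<open>Reconstruction and repair by Vandermonde elimination\<close>

text \<open>In a difference of two words of one coset the syndrome cancels, leaving the homogeneous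
  integer checks that \<open>vandermonde_dvd\<close> expects.\<close>

lemma parity_check_diff:
  assumes "syn x = syn x'" "h < l" "u < w h" "a \<in> A" "t < n - k"
  shows "int p dvd (\<Sum>i\<in>G h. int (i * s + a i) ^ t * (int (x (i, u, a)) - int (x' (i, u, a))))"
proof -
  have "syn x (h, u, a, t) = syn x' (h, u, a, t)" using assms(1) by simp
  then have "(\<Sum>i\<in>G h. (i * s + a i) ^ t * x (i, u, a)) mod p
      = (\<Sum>i\<in>G h. (i * s + a i) ^ t * x' (i, u, a)) mod p"
    using assms(2-) by (simp add: syn_def Q_def)
  then have "int (\<Sum>i\<in>G h. (i * s + a i) ^ t * x (i, u, a)) mod int p
      = int (\<Sum>i\<in>G h. (i * s + a i) ^ t * x' (i, u, a)) mod int p"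
    by (simp only: of_nat_mod[symmetric])
  then have "int p dvd int (\<Sum>i\<in>G h. (i * s + a i) ^ t * x (i, u, a))
      - int (\<Sum>i\<in>G h. (i * s + a i) ^ t * x' (i, u, a))"
    by (rule mod_eq_dvd_iff[THEN iffD1])
  also have "\<dots> = (\<Sum>i\<in>G h. int (i * s + a i) ^ t * (int (x (i, u, a)) - int (x' (i, u, a))))"
    by (simp add: sum_subtractf right_diff_distrib)
  finally show ?thesis .
qed

lemma word_eqI:
  assumes "x \<in> W" "x' \<in> W" "e \<in> \<Omega>" "int p dvd int (x e) - int (x' e)"
  shows "x e = x' e"
proof -
  have "x e < p" "x' e < p" using assms by (auto simp: W_def)
  moreover have "int (x e) mod int p = int (x' e) mod int p"
    using assms(4) by (rule mod_eq_dvd_iff[THEN iffD2])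
  ultimately show ?thesis by simp
qed

text \<open>The numbers \<open>i * s + v\<close> with \<open>v < s\<close> determine
  \<open>i\<close> and \<open>v\<close> by division with remainder, and all lie below
  \<open>n * s < p\<close>, so they remain distinct modulo \<open>p\<close>.\<close>

lemma points_distinct:
  assumes "i < n" "j < n" "v < s" "v' < s" "(i, v) \<noteq> (j, v')"
  shows "\<not> int p dvd int (i * s + v) - int (j * s + v')"
proof -
  have bound: "m * s + u < p" if "m < n" "u < s" for m u
  proof -
    have "m * s + u < Suc m * s" using that by simp
    also have "\<dots> \<le> n * s" using that by (intro mult_right_mono) auto
    finally show ?thesis using p_gt by simp
  qed
  have "i * s + v \<noteq> j * s + v'"
  proof
    assume eq: "i * s + v = j * s + v'"
    from arg_cong[OF eq, of "\<lambda>u. u div s"] arg_cong[OF eq, of "\<lambda>u. u mod s"]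
    show False using assms by simp
  qed
  moreover have "int (i * s + v) mod int p = int (i * s + v)" "int (j * s + v') mod int p = int (j * s + v')"
    using bound assms(1-4) by (simp_all only: of_nat_mod[symmetric] mod_less)
  ultimately show ?thesis by (metis mod_eq_dvd_iff of_nat_eq_iff)
qed

lemma node_eq_iff:
  "node i x = node i x' \<longleftrightarrow> (\<forall>u<w (g i). \<forall>a\<in>A. x (i, u, a) = x' (i, u, a))"
  by (auto simp: node_def fun_eq_iff restrict_def)

text \<open>At most \<open>n - k\<close> nodes of a group lie outside \<open>K\<close>. In each row
  their differences satisfy \<open>n - k\<close> checks with distinct points, hence vanish modulo
  \<open>p\<close>.\<close>

lemma node_determined:
  assumes x: "x \<in> W" "x' \<in> W" "syn x = syn x'" and K: "K \<subseteq> {0..<n}" "card K = k"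
    and eq: "\<And>j. j \<in> K \<Longrightarrow> node j x = node j x'" and i: "i < n" "u < w (g i)" "a \<in> A"
  shows "x (i, u, a) = x' (i, u, a)"
proof (cases "i \<in> K")
  case True
  then show ?thesis using eq[OF True] i unfolding node_eq_iff by blast
next
  case False
  let ?y = "\<lambda>j. int (x (j, u, a)) - int (x' (j, u, a))"
  let ?J = "G (g i) - K"
  have cJ: "card ?J \<le> n - k"
  proof -
    have "card ?J \<le> card ({0..<n} - K)" by (intro card_mono) (auto simp: G_def)
    also have "\<dots> = n - k" using K by (simp add: card_Diff_subset finite_subset)
    finally show ?thesis .
  qed
  have "int p dvd ?y i"
  proof (rule vandermonde_dvd[where J = ?J and x = "\<lambda>j. int (j * s + a j)" and y = ?y and j = i])
    show "finite ?J" using finite_G by simp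
    show "prime (int p)" using prime by simp
    show "\<not> int p dvd int (j * s + a j) - int (j' * s + a j')" if "j \<in> ?J" "j' \<in> ?J" "j \<noteq> j'" for j j'
      using that A_less[OF i(3)] by (intro points_distinct) (auto simp: G_def)
    show "i \<in> ?J" using False i by (auto simp: G_def)
    fix t assume "t < card ?J"
    then have "int p dvd (\<Sum>j\<in>G (g i). int (j * s + a j) ^ t * ?y j)"
      using cJ i x g_less by (intro parity_check_diff) auto
    also have "(\<Sum>j\<in>G (g i). int (j * s + a j) ^ t * ?y j) = (\<Sum>j\<in>?J. int (j * s + a j) ^ t * ?y j)"
    proof (intro sum.mono_neutral_right ballI)
      fix j assume "j \<in> G (g i) - ?J"
      then have "j \<in> K" "g j = g i" by (auto simp: G_def)
      then have "x (j, u, a) = x' (j, u, a)" using eq[of j] i unfolding node_eq_iff by auto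
      then show "int (j * s + a j) ^ t * ?y j = 0" by simp
    qed (auto simp: finite_G)
    finally show "int p dvd (\<Sum>j\<in>?J. int (j * s + a j) ^ t * ?y j)" .
  qed
  then show ?thesis using x i by (intro word_eqI) (auto simp: \<Omega>_def)
qed

text \<open>Summing the checks at \<open>a\<close> over all values of the digit \<open>a i\<close> leaves a Vandermonde system in
  the \<open>s\<close> symbols of node \<open>i\<close> and one digit sum for every other node of the group.\<close>

lemma node_repaired:
  assumes x: "x \<in> W" "x' \<in> W" "syn x = syn x'" and i: "i < n"
    and D: "D \<subseteq> G (g i) - {i}" "card (G (g i)) \<le> card D + (n - d)"
    and eq: "\<And>j. j \<in> D \<Longrightarrow> msg i (node j x) = msg i (node j x')"
  shows "node i x = node i x'"
  unfolding node_eq_iff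
proof (intro allI impI ballI)
  fix u a assume u: "u < w (g i)" and a: "a \<in> A"
  let ?y = "\<lambda>j v. int (x (j, u, a(i := v))) - int (x' (j, u, a(i := v)))"
  define E where "E = G (g i) - D - {i}"
  \<comment> \<open>The unknowns, labelled by their points: all \<open>s\<close> symbols of node
    \<open>i\<close> in the class of \<open>a\<close>, and one digit sum for each node of
    \<open>E\<close>. Digit \<open>j\<close> stays \<open>a j\<close> because only digit
    \<open>i\<close> varies.\<close>
  define J where "J = Pair i ` {..<s} \<union> (\<lambda>j. (j, a j)) ` E"
  define pt where "pt = (\<lambda>(j, v). int (j * s + v))"
  define Y where "Y = (\<lambda>(j, v). if j = i then ?y i v else (\<Sum>v<s. ?y j v))"
  have finE: "finite E" "i \<notin> E" using finite_G by (auto simp: E_def)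
  have iG: "i \<in> G (g i)" using i by (simp add: G_def)
  have disj: "Pair i ` {..<s} \<inter> (\<lambda>j. (j, a j)) ` E = {}" using finE by auto
  have split: "G (g i) = insert i (D \<union> E)" using D iG by (auto simp: E_def)
  have finD: "finite D" using D finite_G finite_subset by blast
  have "card (G (g i)) = Suc (card D + card E)"
  proof -
    have "D \<inter> E = {}" "i \<notin> D \<union> E" using D by (auto simp: E_def)
    then show ?thesis unfolding split using finD finE by (simp add: card_Un_disjoint)
  qed
  then have cE: "Suc (card E) \<le> n - d" using D(2) by simp
  \<comment> \<open>The count is at most \<open>s + (n - d - 1)\<close>, which equals
    \<open>n - k\<close> by the choice of \<open>s\<close>.\<close>
  have cJ: "card J \<le> n - k"
  proof -
    have "card J \<le> card {..<s} + card E"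
      unfolding J_def using finE
      by (intro card_Un_le[THEN order_trans] add_mono card_image_le) auto
    then show ?thesis using cE s_eq d_less by simp
  qed
  have msg_dvd: "int p dvd (\<Sum>v<s. ?y j v)" if j: "j \<in> D" for j
  proof -
    have gj: "g j = g i" using D j by (auto simp: G_def)
    have a0: "a(i := 0) \<in> A" using a i s_pos by (rule A_upd)
    have "msg i (node j x) (u, a(i := 0)) = msg i (node j x') (u, a(i := 0))" using eq[OF j] by simp
    then have "(\<Sum>v<s. x (j, u, a(i := v))) mod p = (\<Sum>v<s. x' (j, u, a(i := v))) mod p"
      using u a0 A_upd[OF a i] gj by (simp add: msg_def node_def)
    then have "int (\<Sum>v<s. x (j, u, a(i := v))) mod int p = int (\<Sum>v<s. x' (j, u, a(i := v))) mod int p"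
      by (simp only: of_nat_mod[symmetric])
    then have "int p dvd int (\<Sum>v<s. x (j, u, a(i := v))) - int (\<Sum>v<s. x' (j, u, a(i := v)))"
      by (rule mod_eq_dvd_iff[THEN iffD1])
    then show ?thesis by (simp add: sum_subtractf)
  qed
  have "int p dvd Y (i, a i)"
  proof (rule vandermonde_dvd[where J = J and x = pt and y = Y and j = "(i, a i)"])
    show "finite J" using finE by (simp add: J_def)
    show "prime (int p)" using prime by simp
    show "(i, a i) \<in> J" using A_less[OF a i] by (simp add: J_def)
    show "\<not> int p dvd pt e - pt e'" if "e \<in> J" "e' \<in> J" "e \<noteq> e'" for e e'
    proof -
      have lt: "fst e < n \<and> snd e < s" if "e \<in> J" for e
        using that i A_less[OF a] by (auto simp: J_def E_def G_def)
      show ?thesis using points_distinct[of "fst e" "fst e'" "snd e" "snd e'"] lt that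
        by (simp add: pt_def case_prod_unfold)
    qed
    fix t assume t: "t < card J"
    let ?c = "\<lambda>j v. int (j * s + (a(i := v)) j) ^ t * ?y j v"
    have "int p dvd (\<Sum>v<s. \<Sum>j\<in>G (g i). ?c j v)"
      using t cJ by (intro dvd_sum[OF parity_check_diff[OF x(3) g_less[OF i] u A_upd[OF a i]]]) auto
    also have "(\<Sum>v<s. \<Sum>j\<in>G (g i). ?c j v) = (\<Sum>j\<in>G (g i). \<Sum>v<s. ?c j v)"
      by (rule sum.swap)
    also have "\<dots> = (\<Sum>v<s. ?c i v) + ((\<Sum>j\<in>D. \<Sum>v<s. ?c j v) + (\<Sum>j\<in>E. \<Sum>v<s. ?c j v))"
    proof -
      have "i \<notin> D \<union> E" "D \<inter> E = {}" using D by (auto simp: E_def)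
      then show ?thesis unfolding split using finD finE by (simp add: sum.union_disjoint)
    qed
    \<comment> \<open>For \<open>j\<close> other than \<open>i\<close> the evaluation point does not
      depend on \<open>v\<close>, so the helper's digit sum factors out, and it vanishes modulo
      \<open>p\<close> by \<open>msg_dvd\<close>.\<close>
    also have "(\<Sum>j\<in>D. \<Sum>v<s. ?c j v) = (\<Sum>j\<in>D. int (j * s + a j) ^ t * (\<Sum>v<s. ?y j v))"
      unfolding sum_distrib_left using D by (intro sum.cong refl) auto
    finally have "int p dvd (\<Sum>j\<in>D. int (j * s + a j) ^ t * (\<Sum>v<s. ?y j v)) +
        ((\<Sum>v<s. ?c i v) + (\<Sum>j\<in>E. \<Sum>v<s. ?c j v))" by (simp only: ac_simps)
    moreover have "int p dvd (\<Sum>j\<in>D. int (j * s + a j) ^ t * (\<Sum>v<s. ?y j v))"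
      by (intro dvd_sum dvd_mult msg_dvd)
    ultimately have "int p dvd (\<Sum>v<s. ?c i v) + (\<Sum>j\<in>E. \<Sum>v<s. ?c j v)"
      by (rule dvd_add_right_iff[THEN iffD1, rotated])
    also have "(\<Sum>v<s. ?c i v) = (\<Sum>e\<in>Pair i ` {..<s}. pt e ^ t * Y e)"
      by (subst sum.reindex) (auto simp: pt_def Y_def inj_on_def)
    also have "(\<Sum>j\<in>E. \<Sum>v<s. ?c j v) = (\<Sum>e\<in>(\<lambda>j. (j, a j)) ` E. pt e ^ t * Y e)"
      using finE(2) by (subst sum.reindex) (auto simp: pt_def Y_def inj_on_def sum_distrib_left intro!: sum.cong)
    also have "(\<Sum>e\<in>Pair i ` {..<s}. pt e ^ t * Y e) + (\<Sum>e\<in>(\<lambda>j. (j, a j)) ` E. pt e ^ t * Y e)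
        = (\<Sum>e\<in>J. pt e ^ t * Y e)"
      unfolding J_def using finE disj by (intro sum.union_disjoint[symmetric]) auto
    finally show "int p dvd (\<Sum>e\<in>J. pt e ^ t * Y e)" .
  qed
  \<comment> \<open>Setting digit \<open>i\<close> to \<open>a i\<close> gives back the row
    \<open>a\<close>.\<close>
  then have "int p dvd int (x (i, u, a)) - int (x' (i, u, a))" by (simp add: Y_def)
  then show "x (i, u, a) = x' (i, u, a)" using x i u a by (intro word_eqI) (auto simp: \<Omega>_def)
qed

section \<open>Storage, repair traffic and the resulting array code\<close>

lemma card_A_zero:
  assumes "i < n"
  shows "card {a \<in> A. a i = 0} = s ^ (n - 1)"
proof -
  have "{a \<in> A. a i = 0} = PiE {..<n} (\<lambda>j. if j = i then {0} else {..<s})"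
  proof (intro equalityI subsetI)
    fix a assume a: "a \<in> PiE {..<n} (\<lambda>j. if j = i then {0} else {..<s})"
    have "a j < s" if "j < n" for j
      using PiE_mem[OF a, of j] that s_pos by (cases "j = i") auto
    moreover have "a i = 0" using PiE_mem[OF a, of i] assms by simp
    moreover have "a \<in> extensional {..<n}" using a by (simp add: PiE_def)
    ultimately show "a \<in> {a \<in> A. a i = 0}" by (simp add: A_def PiE_iff)
  qed (auto simp: A_def PiE_iff)
  then have "card {a \<in> A. a i = 0} = (\<Prod>j<n. card (if j = i then {0} else {..<s}))"
    by (simp only: card_PiE finite_lessThan)
  also have "\<dots> = (\<Prod>j\<in>{..<n} - {i}. s)"
    using assms by (simp add: prod.remove[of "{..<n}" i])
  finally show ?thesis using assms by simp
qed

lemma card_node_image: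
  assumes "i < n"
  shows "card (node i ` W) \<le> p ^ (w (g i) * s ^ n)"
proof -
  have "card (node i ` W) \<le> card ({..<w (g i)} \<times> A \<rightarrow>\<^sub>E {..<p})"
  proof (rule card_mono)
    show "finite ({..<w (g i)} \<times> A \<rightarrow>\<^sub>E {..<p})" using finite_A by (intro finite_PiE) auto
    show "node i ` W \<subseteq> {..<w (g i)} \<times> A \<rightarrow>\<^sub>E {..<p}"
    proof (intro image_subsetI PiE_I)
      fix x e assume "x \<in> W" "e \<in> {..<w (g i)} \<times> A"
      moreover from this have "(i, fst e, snd e) \<in> \<Omega>" using assms by (auto simp: \<Omega>_def)
      ultimately show "node i x e \<in> {..<p}" by (auto simp: node_def W_def)
    qed (auto simp: node_def)
  qed
  also have "\<dots> = p ^ (w (g i) * s ^ n)"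
    using finite_A by (simp add: card_PiE card_cartesian_product card_A)
  finally show ?thesis .
qed

lemma card_msg_image:
  assumes "i < n"
  shows "card (msg i ` Z) \<le> p ^ (w (g i) * s ^ (n - 1))"
proof -
  let ?X = "{..<w (g i)} \<times> {a \<in> A. a i = 0}"
  have "card (msg i ` Z) \<le> card (?X \<rightarrow>\<^sub>E {..<p})"
  proof (rule card_mono)
    show "finite (?X \<rightarrow>\<^sub>E {..<p})" using finite_A by (intro finite_PiE) auto
    show "msg i ` Z \<subseteq> ?X \<rightarrow>\<^sub>E {..<p}" using p_pos by (auto simp: msg_def split: if_splits)
  qed
  also have "\<dots> = p ^ (w (g i) * s ^ (n - 1))"
    using finite_A by (simp add: card_PiE card_cartesian_product card_A_zero[OF assms])
  finally show ?thesis .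
qed

text \<open>The code is a large coset. Of the helpers in the failed node's group exactly
  \<open>card (G (g i)) - (n - d)\<close> are used, so the total traffic depends on that group alone
  and not on the helper set.\<close>

lemma exists_array_code:
  assumes G: "\<And>h. h < l \<Longrightarrow> n - k \<le> card (G h)" and N: "\<And>h. h < l \<Longrightarrow> w h * s ^ n \<le> N"
  shows "\<exists>\<omega> M. array_code n k d p N \<omega> M node \<and>
    p ^ (\<Sum>h<l. (card (G h) - (n - k)) * (w h * s ^ n)) \<le> card M \<and>
    (\<forall>i<n. \<forall>H. H \<subseteq> {0..<n} - {i} \<longrightarrow> card H = d \<longrightarrow>
      (\<Sum>j\<in>H. \<omega> i H j) = (card (G (g i)) - (n - d)) * (w (g i) * s ^ (n - 1)))"
proof -
  obtain y where y: "p ^ (\<Sum>h<l. (card (G h) - (n - k)) * (w h * s ^ n)) \<le> card {x \<in> W. syn x = y}"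
    using large_coset G by blast
  define M where "M = {x \<in> W. syn x = y}"
  have "card M > 0" using y p_pos by (metis M_def gr0I le_zero_eq power_not_zero)
  then have M: "finite M" "M \<noteq> {}" "M \<subseteq> W" by (auto simp: M_def card_gt_0_iff)
  have M_iff: "x \<in> W" "x' \<in> W" "syn x = syn x'" if "x \<in> M" "x' \<in> M" for x x'
    using that by (auto simp: M_def)
  define D where "D = (\<lambda>i H. SOME D. D \<subseteq> H \<inter> G (g i) \<and> card D = card (G (g i)) - (n - d))"
  have D: "D i H \<subseteq> H \<inter> G (g i) \<and> card (D i H) = card (G (g i)) - (n - d)"
    if iH: "i < n" "H \<subseteq> {0..<n} - {i}" "card H = d" for i H
  proof -
    have finH: "finite H" using iH finite_subset by blast
    \<comment> \<open>Only \<open>n - d\<close> nodes, the failed one included, lie outside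
      \<open>H\<close>; enough helpers therefore remain in the group.\<close>
    have "card (G (g i)) \<le> card (H \<inter> G (g i)) + card (G (g i) - H)"
      by (metis Int_commute card_Int_Diff finite_G order_refl)
    also have "card (G (g i) - H) \<le> card ({0..<n} - H)"
      by (intro card_mono) (auto simp: G_def)
    also have "card ({0..<n} - H) = n - d"
      using iH finH by (subst card_Diff_subset) auto
    finally have "card (G (g i)) - (n - d) \<le> card (H \<inter> G (g i))" by simp
    then have "\<exists>D. D \<subseteq> H \<inter> G (g i) \<and> card D = card (G (g i)) - (n - d)"
      by (meson obtain_subset_with_card_n)
    then show ?thesis unfolding D_def by (rule someI_ex)
  qed
  define \<omega> where "\<omega> = (\<lambda>i H j. if j \<in> D i H then w (g i) * s ^ (n - 1) else 0)"
  have "array_code n k d p N \<omega> M node"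
  proof (rule array_codeI)
    show "finite M" "M \<noteq> {}" using M by auto
    fix i assume i: "i < n"
    have "card (node i ` M) \<le> card (node i ` W)"
      using M finite_W by (intro card_mono) auto
    also have "\<dots> \<le> p ^ (w (g i) * s ^ n)" using i by (rule card_node_image)
    also have "\<dots> \<le> p ^ N" using N[OF g_less[OF i]] p_pos by (intro power_increasing) auto
    finally show "card (node i ` M) \<le> p ^ N" .
  next
    fix K x x' assume K: "K \<subseteq> {0..<n}" "card K = k" and x: "x \<in> M" "x' \<in> M"
      and eq: "\<And>j. j \<in> K \<Longrightarrow> node j x = node j x'"
    show "x = x'"
    proof (rule PiE_ext[of x \<Omega> "\<lambda>_. {..<p}"])
      show "x \<in> \<Omega> \<rightarrow>\<^sub>E {..<p}" "x' \<in> \<Omega> \<rightarrow>\<^sub>E {..<p}" using x M by (auto simp: W_def)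
      fix e assume "e \<in> \<Omega>"
      then show "x e = x' e" using node_determined[OF M_iff[OF x] K eq] by (auto simp: \<Omega>_def)
    qed
  next
    fix i H assume iH: "i < n" "H \<subseteq> {0..<n} - {i}" "card H = d"
    \<comment> \<open>An idle helper sends a constant, that is at most \<open>p ^ 0\<close>
      different messages.\<close>
    define \<phi> where "\<phi> = (\<lambda>j z. if j \<in> D i H then msg i z else undefined)"
    show "\<exists>\<phi> :: nat \<Rightarrow> (nat \<times> (nat \<Rightarrow> nat) \<Rightarrow> nat) \<Rightarrow> (nat \<times> (nat \<Rightarrow> nat) \<Rightarrow> nat).
        (\<forall>j\<in>H. card ((\<lambda>x. \<phi> j (node j x)) ` M) \<le> p ^ \<omega> i H j) \<and>
        (\<forall>x\<in>M. \<forall>x'\<in>M. (\<forall>j\<in>H. \<phi> j (node j x) = \<phi> j (node j x')) \<longrightarrow> node i x = node i x')"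
    proof (intro exI[of _ \<phi>] conjI ballI impI)
      fix j assume "j \<in> H"
      show "card ((\<lambda>x. \<phi> j (node j x)) ` M) \<le> p ^ \<omega> i H j"
      proof (cases "j \<in> D i H")
        case True
        then show ?thesis using card_msg_image[OF iH(1), of "node j ` M"]
          by (simp add: \<phi>_def \<omega>_def image_image)
      next
        case False
        then have "(\<lambda>x. \<phi> j (node j x)) ` M \<subseteq> {undefined}" by (auto simp: \<phi>_def)
        then have "card ((\<lambda>x. \<phi> j (node j x)) ` M) \<le> 1" using card_mono[of "{undefined}"] by simp
        then show ?thesis using False by (simp add: \<omega>_def)
      qed
    next
      fix x x' assume x: "x \<in> M" "x' \<in> M" and eq: "\<forall>j\<in>H. \<phi> j (node j x) = \<phi> j (node j x')"
      show "node i x = node i x'"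
      proof (rule node_repaired[OF M_iff[OF x] iH(1)])
        show "D i H \<subseteq> G (g i) - {i}" "card (G (g i)) \<le> card (D i H) + (n - d)"
          using D[OF iH] iH(2) by auto
        fix j assume j: "j \<in> D i H"
        then have "j \<in> H" using D[OF iH] by auto
        then show "msg i (node j x) = msg i (node j x')"
          using bspec[OF eq, of j] j by (simp add: \<phi>_def)
      qed
    qed
  qed
  moreover have "(\<Sum>j\<in>H. \<omega> i H j) = (card (G (g i)) - (n - d)) * (w (g i) * s ^ (n - 1))"
    if iH: "i < n" "H \<subseteq> {0..<n} - {i}" "card H = d" for i H
  proof -
    have "finite H" using iH finite_subset by blast
    moreover have "H \<inter> D i H = D i H" using D[OF iH] by auto
    ultimately have "(\<Sum>j\<in>H. \<omega> i H j) = (\<Sum>j\<in>D i H. w (g i) * s ^ (n - 1))"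
      by (simp add: \<omega>_def sum.If_cases[symmetric] sum.inter_restrict[symmetric])
    then show ?thesis using D[OF iH] by simp
  qed
  ultimately show ?thesis using y unfolding M_def[symmetric]
    by (intro exI[of _ \<omega>] exI[of _ M] conjI allI impI)
qed

end

section \<open>The achievable rate\<close>

text \<open>Consecutive blocks of length \<open>n div l\<close> form the groups; the minimum with
  \<open>l - 1\<close> puts the remainder into the last one.\<close>

lemma card_groups:
  fixes n l :: nat
  assumes "1 \<le> l" "0 < n div l" "h < l"
  shows "card {i. i < n \<and> min (i div (n div l)) (l - 1) = h}
    = (if h < l - 1 then n div l else n - (l - 1) * (n div l))"
proof -
  define f where "f = n div l"
  have f: "0 < f" "l * f \<le> n" using assms(2) by (simp_all add: f_def)
  have lf: "l * f = (l - 1) * f + f" using assms(1) by (cases l) auto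
  have "card {i. i < n \<and> min (i div f) (l - 1) = h} = (if h < l - 1 then f else n - (l - 1) * f)"
  proof (cases "h < l - 1")
    case True
    have "Suc h * f \<le> (l - 1) * f" using True by (intro mult_right_mono) auto
    then have "Suc h * f \<le> n" using f lf by linarith
    then have *: "i < n" if "i < Suc h * f" for i using that by linarith
    have "i < n \<and> min (i div f) (l - 1) = h \<longleftrightarrow> i \<in> {h * f..<Suc h * f}" for i
    proof -
      have "min q (l - 1) = h \<longleftrightarrow> h \<le> q \<and> q < Suc h" for q
        using True by linarith
      then have "min (i div f) (l - 1) = h \<longleftrightarrow> h * f \<le> i \<and> i < Suc h * f"
        by (simp only: less_eq_div_iff_mult_less_eq[OF f(1)] div_less_iff_less_mult[OF f(1)])
      then show ?thesis using * by (metis atLeastLessThan_iff)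
    qed
    then have "{i. i < n \<and> min (i div f) (l - 1) = h} = {h * f..<Suc h * f}"
      by (intro set_eqI) (simp only: mem_Collect_eq)
    then show ?thesis using True by simp
  next
    case False
    then have h: "h = l - 1" using assms by simp
    have "min q (l - 1) = l - 1 \<longleftrightarrow> l - 1 \<le> q" for q by linarith
    then have "min (i div f) (l - 1) = h \<longleftrightarrow> (l - 1) * f \<le> i" for i
      by (simp only: h less_eq_div_iff_mult_less_eq[OF f(1)])
    then have "{i. i < n \<and> min (i div f) (l - 1) = h} = {(l - 1) * f..<n}"
      by (intro set_eqI) (simp only: mem_Collect_eq atLeastLessThan_iff conj_commute)
    then show ?thesis using False by simp
  qed
  then show ?thesis by (simp only: f_def)
qed

text \<open>The nodes are split into \<open>l - 1\<close> groups of \<open>n div l\<close> nodes and one group with the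
  remaining ones. Since the last group contacts more helpers, its words are used with the smaller
  multiplicity \<open>D1\<close> in place of \<open>Dl\<close>, so that the repair bandwidth is the same in all groups.\<close>

lemma exists_grouped_dss:
  fixes n k d l T :: nat
  assumes "k \<le> d" "d < n" "1 \<le> l" "n - k < n div l" "0 < k"
  defines "m \<equiv> n - (l - 1) * (n div l)" and "s \<equiv> d - k + 1"
  defines "K1 \<equiv> n div l - (n - k)" and "D1 \<equiv> n div l - (n - d)"
    and "Kl \<equiv> m - (n - k)" and "Dl \<equiv> m - (n - d)"
  shows "\<exists>p b M c. prime p \<and> exact_repair_dss n k d p (fact n * T * (Dl * s ^ n)) b M c \<and>
    d * b = fact n * T * (D1 * Dl * s ^ (n - 1)) \<and>
    p ^ (fact n * T * (((l - 1) * K1 * Dl + Kl * D1) * s ^ n)) \<le> card M"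
proof -
  obtain p where p: "prime p" "n * s < p" using bigger_prime by blast
  define g where "g = (\<lambda>i. min (i div (n div l)) (l - 1))"
  define w where "w = (\<lambda>h. if h < l - 1 then Dl else D1)"
  interpret grouped_code n k d s p l g w
    using p assms(1-5) by unfold_locales (auto simp: s_def g_def)
  have cG: "card (G h) = (if h < l - 1 then n div l else m)" if "h < l" for h
    unfolding G_def unfolding g_def m_def using card_groups[OF assms(3) _ that, of n] assms(4) by simp
  have "l * (n div l) \<le> n" by simp
  moreover have "l * (n div l) = (l - 1) * (n div l) + n div l" using assms(3) by (cases l) auto
  ultimately have m: "n div l \<le> m" by (simp add: m_def)
  then have D: "D1 \<le> Dl" by (simp add: D1_def Dl_def)
  have sum: "(\<Sum>h<l. (card (G h) - (n - k)) * (w h * s ^ n)) = ((l - 1) * K1 * Dl + Kl * D1) * s ^ n"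
  proof -
    have l: "{..<l} = insert (l - 1) {..<l - 1}" using assms(3) by auto
    have "(\<Sum>h<l. (card (G h) - (n - k)) * (w h * s ^ n))
        = (\<Sum>h<l. if h < l - 1 then K1 * (Dl * s ^ n) else Kl * (D1 * s ^ n))"
      by (intro sum.cong refl) (simp add: cG w_def K1_def Kl_def)
    also have "\<dots> = Kl * (D1 * s ^ n) + (l - 1) * (K1 * (Dl * s ^ n))"
      unfolding l by simp
    finally show ?thesis by (simp add: algebra_simps)
  qed
  have "\<exists>\<omega> M. array_code n k d p (Dl * s ^ n) \<omega> M node \<and>
    p ^ (\<Sum>h<l. (card (G h) - (n - k)) * (w h * s ^ n)) \<le> card M \<and>
    (\<forall>i<n. \<forall>H. H \<subseteq> {0..<n} - {i} \<longrightarrow> card H = d \<longrightarrow>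
      (\<Sum>j\<in>H. \<omega> i H j) = (card (G (g i)) - (n - d)) * (w (g i) * s ^ (n - 1)))"
    using m D assms(4) by (intro exists_array_code) (auto simp: cG w_def)
  then obtain \<omega> M where code: "array_code n k d p (Dl * s ^ n) \<omega> M node"
    and M: "p ^ (((l - 1) * K1 * Dl + Kl * D1) * s ^ n) \<le> card M"
    and \<omega>: "\<And>i H. i < n \<Longrightarrow> H \<subseteq> {0..<n} - {i} \<Longrightarrow> card H = d \<Longrightarrow>
      (\<Sum>j\<in>H. \<omega> i H j) = (card (G (g i)) - (n - d)) * (w (g i) * s ^ (n - 1))"
    unfolding sum by metis
  \<comment> \<open>Ordinary groups use \<open>D1\<close> helpers with multiplicity
    \<open>Dl\<close>, the last one \<open>Dl\<close> helpers with multiplicity \<open>D1\<close>: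
    the products agree.\<close>
  have \<omega>': "(\<Sum>j\<in>H. \<omega> i H j) = D1 * Dl * s ^ (n - 1)"
    if "i < n" "H \<subseteq> {0..<n} - {i}" "card H = d" for i H
    using \<omega>[OF that] cG[OF g_less[OF that(1)]] by (simp add: w_def D1_def Dl_def)
  have "\<exists>b M' c'. exact_repair_dss n k d p (fact n * T * (Dl * s ^ n)) b M' c' \<and>
      d * b = fact n * T * (D1 * Dl * s ^ (n - 1)) \<and> card M' = card M ^ (fact n * T)"
    using assms(1,2,5) by (intro array_code_symmetrize[OF code _ _ \<omega>']) auto
  then obtain b M' c' where dss: "exact_repair_dss n k d p (fact n * T * (Dl * s ^ n)) b M' c'"
    "d * b = fact n * T * (D1 * Dl * s ^ (n - 1))" "card M' = card M ^ (fact n * T)"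
    by (elim exE conjE)
  have "p ^ (fact n * T * (((l - 1) * K1 * Dl + Kl * D1) * s ^ n))
      = (p ^ (((l - 1) * K1 * Dl + Kl * D1) * s ^ n)) ^ (fact n * T)"
    by (simp only: power_mult[symmetric] mult.commute)
  also have "\<dots> \<le> card M'" unfolding dss(3) using M by (intro power_mono) auto
  finally show ?thesis using p(1) dss(1,2) by (intro exI conjI)
qed

section \<open>Passage to the capacity for real parameters\<close>

text \<open>With \<open>t\<close> sub-symbols per symbol, as many code copies are used as fit into
  \<open>\<alpha> * t\<close>. Rounding costs at most one copy, hence at most \<open>F / t\<close>
  in file size, which tends to 0.\<close>

lemma C_exact_ge_rate:
  fixes n k d N \<Gamma> F :: nat and \<alpha> \<gamma> :: real
  assumes dss: "\<And>T. \<exists>p b M c. prime p \<and> exact_repair_dss n k d p (T * N) b M c \<and>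
      d * b = T * \<Gamma> \<and> p ^ (T * F) \<le> card M"
    and "0 < N" "0 < \<alpha>" and \<gamma>: "real \<Gamma> / real N * \<alpha> \<le> \<gamma>"
  shows "ereal (real F / real N * \<alpha>) \<le> C_exact n k d \<alpha> \<gamma>"
proof (rule tendsto_upperbound)
  have "(\<lambda>t. real F / real N * \<alpha> - real F / real (Suc t)) \<longlonglongrightarrow> real F / real N * \<alpha> - 0"
    by (intro tendsto_diff tendsto_const LIMSEQ_Suc lim_const_over_n)
  then show "(\<lambda>t. ereal (real F / real N * \<alpha> - real F / real (Suc t))) \<longlonglongrightarrow> ereal (real F / real N * \<alpha>)"
    by simp
  show "\<forall>\<^sub>F t in sequentially. ereal (real F / real N * \<alpha> - real F / real (Suc t)) \<le> C_exact n k d \<alpha> \<gamma>"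
  proof (intro always_eventually allI)
    fix t0 :: nat
    define t where "t = Suc t0"
    have t: "0 < t" by (simp add: t_def)
    \<comment> \<open>For small \<open>t\<close> this may be 0, which the assumption
      \<open>dss\<close> covers.\<close>
    define T where "T = nat \<lfloor>\<alpha> * real t / real N\<rfloor>"
    have "real T = of_int \<lfloor>\<alpha> * real t / real N\<rfloor>"
      using \<open>0 < \<alpha>\<close> by (simp add: T_def)
    then have T: "real T \<le> \<alpha> * real t / real N" "\<alpha> * real t / real N - 1 \<le> real T"
      by linarith+
    obtain p b M c where p: "prime p" and code: "exact_repair_dss n k d p (T * N) b M c"
      and b: "d * b = T * \<Gamma>" and M: "p ^ (T * F) \<le> card M"
      using dss[of T] by blast
    have "p > 1" using p by (rule prime_gt_1_nat)
    define B where "B = log (real p) (real (card M)) / real t"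
    have "dss_achievable n k d \<alpha> \<gamma> B"
      unfolding dss_achievable_def
    proof (intro exI conjI)
      show "prime p" "(1::nat) > 0" "p = p ^ 1" using p by auto
      show "real (T * N) \<le> \<alpha> * real t" using T(1) \<open>0 < N\<close> by (simp add: field_simps)
      have "real d * real b = real T * real \<Gamma>" using b by (metis of_nat_mult)
      also have "\<dots> \<le> \<alpha> * real t / real N * real \<Gamma>" using T(1) by (intro mult_right_mono) auto
      also have "\<dots> = real \<Gamma> / real N * \<alpha> * real t" by simp
      also have "\<dots> \<le> \<gamma> * real t" using \<gamma> by (intro mult_right_mono) auto
      finally show "real d * real b \<le> \<gamma> * real t" .
    qed (use t code B_def in auto)
    then have "ereal B \<le> C_exact n k d \<alpha> \<gamma>"
      unfolding C_exact_def by (intro Sup_upper) auto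
    moreover have "real F / real N * \<alpha> - real F / real t \<le> B"
    proof -
      have "real (T * F) = log (real p) (real (p ^ (T * F)))"
        using \<open>p > 1\<close> by (simp add: log_nat_power)
      also have "\<dots> \<le> log (real p) (real (card M))"
        using \<open>p > 1\<close> M by (intro log_mono) (auto simp only: of_nat_le_iff, auto)
      finally have *: "real (T * F) / real t \<le> B" unfolding B_def using t by (intro divide_right_mono) auto
      have "(\<alpha> * real t / real N - 1) * real F / real t \<le> real T * real F / real t"
        using T(2) by (intro divide_right_mono mult_right_mono) auto
      moreover have "(\<alpha> * real t / real N - 1) * real F / real t = real F / real N * \<alpha> - real F / real t"
        using t \<open>0 < N\<close> by (simp add: field_simps)
      ultimately show ?thesis using * by simp
    qed
    ultimately show "ereal (real F / real N * \<alpha> - real F / real (Suc t0)) \<le> C_exact n k d \<alpha> \<gamma>"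
      unfolding t_def by (meson ereal_less_eq(3) order_trans)
  qed
qed simp

theorem theorem6p2:
  fixes n k d l :: nat and \<alpha> :: real
  assumes "0 < k" and "k \<le> d" and "d < n" and "\<alpha> > 0"
    and "1 \<le> l" and "int l \<le> \<lfloor>real n / real (n + 1 - k)\<rfloor>"
  shows "let f = \<lfloor>real n / real l\<rfloor>;
             k1 = f - int n + int k; d1 = f - int n + int d;
             kl = int k - (int l - 1) * f; dl = int d - (int l - 1) * f
         in ereal (((real l - 1) * real_of_int k1 + real_of_int kl * real_of_int d1 / real_of_int dl) * \<alpha>)
            \<le> C_exact n k d \<alpha> (real_of_int d1 * \<alpha> / real (d - k + 1))"
proof -
  define f where "f = n div l"
  define m where "m = n - (l - 1) * f"
  define s where "s = d - k + 1"
  define K1 where "K1 = f - (n - k)"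
  define D1 where "D1 = f - (n - d)"
  define Kl where "Kl = m - (n - k)"
  define Dl where "Dl = m - (n - d)"
  have "\<lfloor>real n / real (n + 1 - k)\<rfloor> = int (n div (n + 1 - k))" by (rule floor_divide_of_nat_eq)
  then have "l \<le> n div (n + 1 - k)" using assms(6) by linarith
  \<comment> \<open>This form is symmetric in \<open>l\<close> and \<open>n + 1 - k\<close>, so the
    bound on \<open>l\<close> becomes the lower bound \<open>n + 1 - k\<close> on the group
    size.\<close>
  then have "l * (n + 1 - k) \<le> n" using assms by (simp add: less_eq_div_iff_mult_less_eq)
  then have "n + 1 - k \<le> f"
    using assms(5) by (simp add: f_def less_eq_div_iff_mult_less_eq mult.commute)
  then have f: "n - k < f" using assms by simp
  have "l * f \<le> n" by (simp add: f_def)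
  moreover have "l * f = (l - 1) * f + f" using assms(5) by (cases l) auto
  ultimately have m: "f \<le> m" "(l - 1) * f \<le> n" by (simp_all add: m_def)
  have "int ((l - 1) * f) = (int l - 1) * int f" using assms(5) by simp
  then have im: "int m = int n - (int l - 1) * int f" using m(2) by (simp only: m_def of_nat_diff)
  \<comment> \<open>No subtraction truncates, since
    \<open>n - d \<le> n - k < f \<le> m\<close>.\<close>
  have ints: "int K1 = int f - int n + int k" "int D1 = int f - int n + int d"
    "int Kl = int k - (int l - 1) * int f" "int Dl = int d - (int l - 1) * int f"
    using f m(1) assms im by (simp_all add: K1_def D1_def Kl_def Dl_def of_nat_diff)
  have Dl: "0 < Dl" and s: "0 < s" using f m(1) assms by (simp_all add: Dl_def s_def)
  define N where "N = fact n * (Dl * s ^ n)"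
  define \<Gamma> where "\<Gamma> = fact n * (D1 * Dl * s ^ (n - 1))"
  define F where "F = fact n * (((l - 1) * K1 * Dl + Kl * D1) * s ^ n)"
  have N: "0 < N" using Dl s by (simp add: N_def)
  \<comment> \<open>The extra factor \<open>s\<close> is the denominator \<open>d - k + 1\<close> of
    the repair bandwidth.\<close>
  have sn: "s ^ n = s * s ^ (n - 1)" using assms by (simp add: power_eq_if)
  have rate: "real F / real N = (real l - 1) * real K1 + real Kl * real D1 / real Dl"
    using Dl s assms(5) by (simp add: F_def N_def field_simps of_nat_diff)
  have bandwidth: "real \<Gamma> / real N * \<alpha> = real D1 * \<alpha> / real s"
    using Dl s by (simp add: \<Gamma>_def N_def sn field_simps)
  have "ereal (real F / real N * \<alpha>) \<le> C_exact n k d \<alpha> (real D1 * \<alpha> / real s)"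
  proof (rule C_exact_ge_rate[OF _ N assms(4)])
    show "real \<Gamma> / real N * \<alpha> \<le> real D1 * \<alpha> / real s" using bandwidth by simp
    fix T
    show "\<exists>p b M c. prime p \<and> exact_repair_dss n k d p (T * N) b M c \<and>
        d * b = T * \<Gamma> \<and> p ^ (T * F) \<le> card M"
      using exists_grouped_dss[OF assms(2,3,5) f[unfolded f_def] assms(1), of T]
      by (simp only: N_def \<Gamma>_def F_def K1_def D1_def Kl_def Dl_def m_def s_def f_def ac_simps)
  qed
  moreover have "\<lfloor>real n / real l\<rfloor> = int f" unfolding f_def by (rule floor_divide_of_nat_eq)
  ultimately show ?thesis
    unfolding Let_def rate by (simp only: ints[symmetric] of_int_of_nat_eq s_def)
qed

end
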